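(* Let $0<p<1$, $q=1-p$, and let $\mathcal{M}=(M_k)_{k\ge 0}$ be a sequence of real numbers $M_k\ge 1$ such that $\mu_{\mathcal{M}}=\prod_{k\ge 0}M_k^{p q^{k-1}}<\infty$. Then $\widehat{\mathcal{S}}$, the abstract completion of $\mathcal{S}$ with respect to $\|\cdot\|_{\mathcal{M}}$, can be canonically and continuously embedded in $C^\infty(\mathbb{R})$; that is, there is a continuous injective linear map $\widehat{\mathcal{S}}\to C^\infty(\mathbb{R})$ whose restriction to $\mathcal{S}$ is the inclusion $\mathcal{S}\subset C^\infty(\mathbb{R})$.
   Context: For measurable $f$ on $\mathbb{R}$, $\|f\|_p=\left(\int_{\mathbb{R}}|f(x)|^p\,dx\right)^{1/p}$ (a quasi-norm satisfying $\|f+g\|_p^p\le\|f\|_p^p+\|g\|_p^p$), and $\|f\|_\infty$ is the supremum norm on $\mathbb{R}$. For $f\in C^\infty(\mathbb{R})$ put $\|f\|_{\mathcal{M}}=\sup_{k\ge0}\frac{\|f^{(k)}\|_p}{M_k}$. The class $\mathcal{S}$ is the vector space $$\mathcal{S}=\left\{f\in C^\infty(\mathbb{R}) : \|f\|_{\mathcal{M}}<\infty \text{ and } \limsup_{k\to\infty}\|f^{(k)}\|_\infty^{q^k}\le 1\right\}.$$ $\widehat{\mathcal{S}}$ is its abstract completion (Cauchy sequences in $\mathcal{S}$ modulo sequences tending to $0$ in $\|\cdot\|_{\mathcal{M}}$), with the extended quasi-norm. Continuity of the map into $C^\infty(\mathbb{R})$ means: convergence in $\widehat{\mathcal{S}}$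 implies that the images converge uniformly on $\mathbb{R}$ together with their derivatives of every order. *)

theory Defs
  imports "HOL-Analysis.Analysis"
begin

text \<open>
  Functions are defined on the real line and take values in a scalar field of sort
  \<open>{real_normed_field, euclidean_space}\<close>. Up to isomorphism there are only two such fields, the
  reals and the complex numbers, so both readings of the function spaces are covered at once.
\<close>

text \<open>Powers with a positive exponent on \<open>[0,\<infinity>]\<close>, with \<open>\<infinity>\<close> raised to the power \<open>a\<close> equal to \<open>\<infinity>\<close>.\<close>

definition epow :: "ennreal \<Rightarrow> real \<Rightarrow> ennreal" where
  "epow x a = (if x = \<infinity> then \<infinity> else ennreal (enn2real x powr a))"

definition nderiv :: "nat \<Rightarrow> (real \<Rightarrow> 'a::real_normed_vector) \<Rightarrow> real \<Rightarrow> 'a" where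
  "nderiv k f = ((\<lambda>g x. vector_derivative g (at x)) ^^ k) f"

definition C_infinity :: "(real \<Rightarrow> 'a::real_normed_vector) set" where
  "C_infinity = {f. \<forall>k x. nderiv k f differentiable (at x)}"

definition Lp_qnorm :: "real \<Rightarrow> (real \<Rightarrow> 'a::real_normed_vector) \<Rightarrow> ennreal" where
  "Lp_qnorm p f = epow (\<integral>\<^sup>+ x. ennreal (norm (f x) powr p) \<partial>lborel) (1 / p)"

definition sup_norm :: "(real \<Rightarrow> 'a::real_normed_vector) \<Rightarrow> ennreal" where
  "sup_norm f = (SUP x. ennreal (norm (f x)))"

definition M_qnorm :: "real \<Rightarrow> (nat \<Rightarrow> real) \<Rightarrow> (real \<Rightarrow> 'a::real_normed_vector) \<Rightarrow> ennreal" where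
  "M_qnorm p M f = (SUP k. Lp_qnorm p (nderiv k f) / ennreal (M k))"

definition S_class :: "real \<Rightarrow> (nat \<Rightarrow> real) \<Rightarrow> (real \<Rightarrow> 'a::real_normed_vector) set" where
  "S_class p M = {f \<in> C_infinity. M_qnorm p M f < \<infinity> \<and>
     limsup (\<lambda>k. epow (sup_norm (nderiv k f)) ((1 - p) ^ k)) \<le> 1}"

text \<open>
  The abstract completion: Cauchy sequences in the class modulo sequences tending to zero.
  Its elements are equivalence classes of sequences of functions.
\<close>

definition S_Cauchy :: "real \<Rightarrow> (nat \<Rightarrow> real) \<Rightarrow> (nat \<Rightarrow> real \<Rightarrow> 'a::real_normed_vector) set" where
  "S_Cauchy p M = {u. (\<forall>n. u n \<in> S_class p M) \<and>
     (\<forall>\<epsilon>>0. \<exists>N. \<forall>m\<ge>N. \<forall>n\<ge>N. M_qnorm p M (\<lambda>x. u m x - u n x) < \<epsilon>)}"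

definition S_rel ::
    "real \<Rightarrow> (nat \<Rightarrow> real) \<Rightarrow>
     ((nat \<Rightarrow> real \<Rightarrow> 'a::real_normed_vector) \<times> (nat \<Rightarrow> real \<Rightarrow> 'a)) set" where
  "S_rel p M = {(u, v). u \<in> S_Cauchy p M \<and> v \<in> S_Cauchy p M \<and>
     (\<lambda>n. M_qnorm p M (\<lambda>x. u n x - v n x)) \<longlonglongrightarrow> 0}"

definition S_hat ::
    "real \<Rightarrow> (nat \<Rightarrow> real) \<Rightarrow> (nat \<Rightarrow> real \<Rightarrow> 'a::real_normed_vector) set set" where
  "S_hat p M = S_Cauchy p M // S_rel p M"

definition S_hat_of ::
    "real \<Rightarrow> (nat \<Rightarrow> real) \<Rightarrow> (real \<Rightarrow> 'a::real_normed_vector) \<Rightarrow>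
     (nat \<Rightarrow> real \<Rightarrow> 'a) set" where
  "S_hat_of p M f = S_rel p M `` {\<lambda>_. f}"

definition S_hat_add ::
    "real \<Rightarrow> (nat \<Rightarrow> real) \<Rightarrow> (nat \<Rightarrow> real \<Rightarrow> 'a::real_normed_vector) set \<Rightarrow>
     (nat \<Rightarrow> real \<Rightarrow> 'a) set \<Rightarrow> (nat \<Rightarrow> real \<Rightarrow> 'a) set" where
  "S_hat_add p M A B = (\<Union>u\<in>A. \<Union>v\<in>B. S_rel p M `` {\<lambda>n x. u n x + v n x})"

definition S_hat_diff ::
    "real \<Rightarrow> (nat \<Rightarrow> real) \<Rightarrow> (nat \<Rightarrow> real \<Rightarrow> 'a::real_normed_vector) set \<Rightarrow>
     (nat \<Rightarrow> real \<Rightarrow> 'a) set \<Rightarrow> (nat \<Rightarrow> real \<Rightarrow> 'a) set" where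
  "S_hat_diff p M A B = (\<Union>u\<in>A. \<Union>v\<in>B. S_rel p M `` {\<lambda>n x. u n x - v n x})"

definition S_hat_scale ::
    "real \<Rightarrow> (nat \<Rightarrow> real) \<Rightarrow> 'a::real_normed_field \<Rightarrow> (nat \<Rightarrow> real \<Rightarrow> 'a) set \<Rightarrow>
     (nat \<Rightarrow> real \<Rightarrow> 'a) set" where
  "S_hat_scale p M c A = (\<Union>u\<in>A. S_rel p M `` {\<lambda>n x. c * u n x})"

text \<open>
  The extended quasi-norm. The limit exists and does not depend on the representative, because
  the \<open>p\<close>-th power of the quasi-norm satisfies the triangle inequality.
\<close>

definition S_hat_qnorm ::
    "real \<Rightarrow> (nat \<Rightarrow> real) \<Rightarrow> (nat \<Rightarrow> real \<Rightarrow> 'a::real_normed_vector) set \<Rightarrow> ennreal" where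
  "S_hat_qnorm p M A = lim (\<lambda>n. M_qnorm p M ((SOME u. u \<in> A) n))"

definition S_hat_tendsto ::
    "real \<Rightarrow> (nat \<Rightarrow> real) \<Rightarrow> (nat \<Rightarrow> (nat \<Rightarrow> real \<Rightarrow> 'a::real_normed_vector) set) \<Rightarrow>
     (nat \<Rightarrow> real \<Rightarrow> 'a) set \<Rightarrow> bool" where
  "S_hat_tendsto p M X A \<longleftrightarrow> (\<lambda>n. S_hat_qnorm p M (S_hat_diff p M (X n) A)) \<longlonglongrightarrow> 0"

definition C_infinity_tendsto ::
    "(nat \<Rightarrow> real \<Rightarrow> 'a::real_normed_vector) \<Rightarrow> (real \<Rightarrow> 'a) \<Rightarrow> bool" where
  "C_infinity_tendsto F f \<longleftrightarrow>
     (\<forall>k. uniform_limit UNIV (\<lambda>n. nderiv k (F n)) (nderiv k f) sequentially)"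

end

theory Submission
  imports Defs
begin

text \<open>
  Write \<open>q = 1 - p\<close>. A function \<open>f\<close> in the class comes arbitrarily close to zero, so \<open>|f|\<close> is at
  most the integral of \<open>|f'| = |f'|\<^sup>p |f'|\<^sup>q\<close>; hence \<open>sup |f|\<close> is at most the integral of
  \<open>|f'|\<^sup>p\<close> times \<open>(sup |f'|)\<^sup>q\<close>. Iterating this, the remaining factor is a supremum raised to a power
  of \<open>q\<close>, which the limsup condition makes harmless, and the product of the other factors converges by
  assumption. So the quasi-norm controls the supremum of every derivative on the class, and a Cauchy
  sequence converges uniformly with all its derivatives. Conversely, Fatou's lemma shows that a Cauchy
  sequence with pointwise limit zero tends to zero in the quasi-norm, which gives injectivity.
\<close>

section \<open>Iterated derivatives\<close>

lemma nderiv_0 [simp]: "nderiv 0 f = f"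
  by (simp add: nderiv_def)

lemma nderiv_Suc: "nderiv (Suc k) f x = vector_derivative (nderiv k f) (at x)"
  by (simp add: nderiv_def)

lemma nderiv_has_vector_derivative:
  assumes "f \<in> C_infinity"
  shows "(nderiv k f has_vector_derivative nderiv (Suc k) f x) (at x within A)"
proof -
  have "nderiv k f differentiable (at x)"
    using assms by (auto simp: C_infinity_def)
  then show ?thesis
    unfolding nderiv_Suc vector_derivative_works by (rule has_vector_derivative_at_within)
qed

lemma continuous_on_nderiv:
  assumes "f \<in> C_infinity"
  shows "continuous_on A (nderiv k f)"
  using nderiv_has_vector_derivative[OF assms]
  by (intro continuous_on_vector_derivative) blast

text \<open>Since \<open>nderiv\<close> iterates a choice of derivative, it is computed by
  exhibiting all orders at once: a tower \<open>g\<close> in which each member differentiates to the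
  next. Sums, scalar multiples and limits are treated this way.\<close>

lemma nderiv_eqI:
  assumes "\<And>k x. (g k has_vector_derivative g (Suc k) x) (at x)"
  shows "nderiv k (g 0) = g k"
proof (induction k)
  case (Suc k)
  show ?case
    using assms by (auto simp: nderiv_Suc Suc.IH vector_derivative_at)
qed simp

lemma C_infinityI:
  assumes "\<And>k x. (g k has_vector_derivative g (Suc k) x) (at x)"
  shows "g 0 \<in> C_infinity"
proof -
  have "nderiv k (g 0) differentiable (at x)" for k x
    using nderiv_eqI[where g = g, OF assms] assms[of k x] by (auto intro: differentiableI_vector)
  then show ?thesis
    by (simp add: C_infinity_def)
qed

lemma
  assumes "f \<in> C_infinity" "g \<in> C_infinity"
  shows C_infinity_add: "(\<lambda>x. f x + g x) \<in> C_infinity"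
    and nderiv_add: "nderiv k (\<lambda>x. f x + g x) = (\<lambda>x. nderiv k f x + nderiv k g x)"
proof -
  define h where "h = (\<lambda>k x. nderiv k f x + nderiv k g x)"
  have h: "(h k has_vector_derivative h (Suc k) x) (at x)" for k x
    unfolding h_def
    by (intro has_vector_derivative_add nderiv_has_vector_derivative assms)
  show "(\<lambda>x. f x + g x) \<in> C_infinity" "nderiv k (\<lambda>x. f x + g x) = (\<lambda>x. nderiv k f x + nderiv k g x)"
    using C_infinityI[where g = h, OF h] nderiv_eqI[where g = h, OF h] by (simp_all add: h_def)
qed

lemma
  fixes c :: "'a::real_normed_field"
  assumes "f \<in> C_infinity"
  shows C_infinity_scale: "(\<lambda>x. c * f x) \<in> C_infinity"
    and nderiv_scale: "nderiv k (\<lambda>x. c * f x) = (\<lambda>x. c * nderiv k f x)"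
proof -
  define h where "h = (\<lambda>k x. c * nderiv k f x)"
  have h: "(h k has_vector_derivative h (Suc k) x) (at x)" for k x
    unfolding h_def
    by (intro has_vector_derivative_mult_right nderiv_has_vector_derivative assms)
  show "(\<lambda>x. c * f x) \<in> C_infinity" "nderiv k (\<lambda>x. c * f x) = (\<lambda>x. c * nderiv k f x)"
    using C_infinityI[where g = h, OF h] nderiv_eqI[where g = h, OF h] by (simp_all add: h_def)
qed

text \<open>Adapts \<open>has_derivative_sequence\<close> to vector derivatives. That result only
  provides some limit function \<open>G\<close>, which uniqueness of limits identifies with
  \<open>g\<close>.\<close>

lemma uniform_limit_vector_derivative:
  fixes f :: "nat \<Rightarrow> real \<Rightarrow> 'a::banach"
  assumes der: "\<And>n x. (f n has_vector_derivative f' n x) (at x)"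
    and f: "\<And>x. (\<lambda>n. f n x) \<longlonglongrightarrow> g x"
    and f': "uniform_limit UNIV f' g' sequentially"
  shows "(g has_vector_derivative g' x) (at x)"
proof -
  have "\<forall>\<^sub>F n in sequentially. \<forall>x\<in>UNIV. \<forall>h. norm (h *\<^sub>R f' n x - h *\<^sub>R g' x) \<le> e * norm h"
    if "e > 0" for e
    using uniform_limitD[OF f' that]
  proof eventually_elim
    case (elim n)
    show ?case
    proof (intro ballI allI)
      fix x h :: real
      have "norm (h *\<^sub>R f' n x - h *\<^sub>R g' x) = \<bar>h\<bar> * norm (f' n x - g' x)"
        by (simp flip: scaleR_diff_right)
      also have "\<dots> \<le> \<bar>h\<bar> * e"
        using elim by (intro mult_left_mono) (auto simp: dist_norm less_imp_le)
      finally show "norm (h *\<^sub>R f' n x - h *\<^sub>R g' x) \<le> e * norm h"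
        by (simp add: mult.commute)
    qed
  qed
  then have "\<exists>G. \<forall>x\<in>UNIV. (\<lambda>n. f n x) \<longlonglongrightarrow> G x \<and> (G has_derivative (\<lambda>h. h *\<^sub>R g' x)) (at x)"
    using has_derivative_sequence[of UNIV f "\<lambda>n x h. h *\<^sub>R f' n x" "\<lambda>x h. h *\<^sub>R g' x" 0 "g 0"]
      der f by (auto simp: has_vector_derivative_def)
  then obtain G where G: "\<And>x. (\<lambda>n. f n x) \<longlonglongrightarrow> G x"
      "\<And>x. (G has_derivative (\<lambda>h. h *\<^sub>R g' x)) (at x)"
    by blast
  have "G = g"
    using LIMSEQ_unique[OF G(1) f] by auto
  with G(2) show ?thesis
    by (simp add: has_vector_derivative_def)
qed

text \<open>After division by \<open>a + b\<close> the two fractions add up to 1 and lie in the unit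
  interval, where \<open>t \<le> t powr p\<close>.\<close>

lemma powr_add_le_add_powr:
  fixes a b p :: real
  assumes "0 \<le> a" "0 \<le> b" "0 < p" "p \<le> 1"
  shows "(a + b) powr p \<le> a powr p + b powr p"
proof (cases "a + b = 0")
  case False
  define s where "s = a + b"
  have s: "0 < s" using False assms by (auto simp: s_def)
  have le: "t / s \<le> (t / s) powr p" if "0 \<le> t" "t \<le> s" for t
  proof (cases "t = 0")
    case False
    then show ?thesis
      using powr_mono'[of p 1 "t / s"] that s assms by simp
  qed simp
  have "1 = a / s + b / s"
    using s by (simp add: s_def flip: add_divide_distrib)
  also have "\<dots> \<le> (a / s) powr p + (b / s) powr p"
    using le[of a] le[of b] assms by (simp add: s_def)
  also have "\<dots> = (a powr p + b powr p) / s powr p"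
    using s assms by (simp add: powr_divide add_divide_distrib)
  finally show ?thesis
    using s by (simp add: s_def field_simps)
qed (use assms in auto)

section \<open>The quasi-norms\<close>

lemma powr_le_iff:
  fixes r c t :: real
  assumes "0 \<le> r" "0 \<le> c" "0 < t"
  shows "r powr t \<le> c \<longleftrightarrow> r \<le> c powr (1 / t)"
  using assms powr_mono2[of "1 / t" "r powr t" c] powr_mono2[of t r "c powr (1 / t)"]
  by (auto simp: powr_powr)

text \<open>An infinite \<open>x\<close> makes both sides false because the bounds are real. Through
  this equivalence later estimates avoid computing with extended powers.\<close>

lemma epow_le_iff:
  assumes "0 < t" "0 \<le> c"
  shows "epow x t \<le> ennreal c \<longleftrightarrow> x \<le> ennreal (c powr (1 / t))"
  using assms by (cases x) (auto simp: epow_def top_unique powr_le_iff)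

lemma Lp_qnorm_le_iff:
  fixes f :: "real \<Rightarrow> 'a::real_normed_vector"
  assumes "0 < p" "0 \<le> c"
  shows "Lp_qnorm p f \<le> ennreal c \<longleftrightarrow>
    (\<integral>\<^sup>+ x. ennreal (norm (f x) powr p) \<partial>lborel) \<le> ennreal (c powr p)"
  using assms by (simp add: Lp_qnorm_def epow_le_iff)

lemma epow_sup_norm_le_iff:
  assumes "0 < t" "0 \<le> c"
  shows "epow (sup_norm f) t \<le> ennreal c \<longleftrightarrow> (\<forall>x. norm (f x) powr t \<le> c)"
  using assms by (simp add: epow_le_iff sup_norm_def SUP_le_iff powr_le_iff)

text \<open>Clears the supremum, the division by \<open>M k\<close> and the outer root, leaving one
  integral inequality with a real bound for each order. The estimates of the quasi-norm pass through
  this form.\<close>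

lemma M_qnorm_le_iff:
  fixes f :: "real \<Rightarrow> 'a::real_normed_vector"
  assumes "0 < p" "0 \<le> c" and M: "\<And>k. 0 < M k"
  shows "M_qnorm p M f \<le> ennreal c \<longleftrightarrow>
    (\<forall>k. (\<integral>\<^sup>+ x. ennreal (norm (nderiv k f x) powr p) \<partial>lborel) \<le> ennreal ((c * M k) powr p))"
proof -
  have "x / ennreal (M k) \<le> ennreal c \<longleftrightarrow> x \<le> ennreal (c * M k)" for x k
  proof (cases x)
    case (real r)
    then show ?thesis
      using M[of k] assms(2) by (simp add: divide_ennreal pos_divide_le_eq)
  next
    case top
    then show ?thesis
      by (simp add: ennreal_top_divide top_unique)
  qed
  then have "M_qnorm p M f \<le> ennreal c \<longleftrightarrow> (\<forall>k. Lp_qnorm p (nderiv k f) \<le> ennreal (c * M k))"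
    by (simp add: M_qnorm_def SUP_le_iff)
  then show ?thesis
    using assms by (simp add: Lp_qnorm_le_iff less_imp_le)
qed

text \<open>The fundamental theorem of calculus bounds the increment by the integral of
  \<open>norm (f' x)\<close> over the interval, and passing to the whole line can only enlarge that
  integral.\<close>

lemma norm_diff_le_nn_integral:
  fixes f :: "real \<Rightarrow> 'a::euclidean_space"
  assumes der: "\<And>x. (f has_vector_derivative f' x) (at x)"
    and cont: "continuous_on UNIV f'"
    and int: "(\<integral>\<^sup>+ x. ennreal (norm (f' x)) \<partial>lborel) \<le> ennreal B" and "0 \<le> B" and "a \<le> b"
  shows "norm (f b - f a) \<le> B"
proof -
  have c: "continuous_on {a..b} f'"
    using cont continuous_on_subset by blast
  have FTC: "(f' has_integral (f b - f a)) {a..b}"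
    using \<open>a \<le> b\<close> der by (intro fundamental_theorem_of_calculus) (auto intro: has_vector_derivative_at_within)
  have cn: "continuous_on {a..b} (\<lambda>x. norm (f' x))"
    using c by (intro continuous_intros)
  have si: "set_integrable lborel {a..b} (\<lambda>x. norm (f' x))"
    unfolding set_integrable_def using cn by (intro borel_integrable_compact) auto
  have "norm (f b - f a) = norm (integral {a..b} f')"
    using FTC by (simp add: integral_unique)
  also have "\<dots> \<le> integral {a..b} (\<lambda>x. norm (f' x))"
    using c cn by (intro integral_norm_bound_integral integrable_continuous_real) auto
  \<comment> \<open>The gauge integral of the fundamental theorem is turned into a Lebesgue
    integral, to be compared with the nonnegative integral in \<open>int\<close>.\<close>
  also have "\<dots> = (LINT x:{a..b}|lborel. norm (f' x))"
    using si by (simp add: set_borel_integral_eq_integral)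
  also have "\<dots> \<le> B"
  proof -
    have "ennreal (LINT x:{a..b}|lborel. norm (f' x)) =
        (\<integral>\<^sup>+ x. ennreal (indicator {a..b} x *\<^sub>R norm (f' x)) \<partial>lborel)"
      using si unfolding set_lebesgue_integral_def set_integrable_def
      by (subst nn_integral_eq_integral) auto
    also have "\<dots> \<le> (\<integral>\<^sup>+ x. ennreal (norm (f' x)) \<partial>lborel)"
      by (intro nn_integral_mono) (auto simp: indicator_def)
    also have "\<dots> \<le> ennreal B" by (fact int)
    finally show ?thesis
      using \<open>0 \<le> B\<close> by simp
  qed
  finally show ?thesis .
qed

text \<open>One step of the iteration: bound \<open>|f'|\<close> by \<open>|f'|\<^sup>p B\<^bsup>1-p\<^esup>\<close> under the integral sign.\<close>

lemma sup_bound_step: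
  fixes f :: "real \<Rightarrow> 'a::euclidean_space"
  assumes p: "0 < p" "p < 1"
    and der: "\<And>x. (f has_vector_derivative f' x) (at x)"
    and cont: "continuous_on UNIV f'"
    and f: "(\<integral>\<^sup>+ x. ennreal (norm (f x) powr p) \<partial>lborel) < \<infinity>"
    and f': "(\<integral>\<^sup>+ x. ennreal (norm (f' x) powr p) \<partial>lborel) \<le> ennreal P" and "0 \<le> P"
    and B: "\<And>x. norm (f' x) \<le> B"
  shows "norm (f x) \<le> P * B powr (1 - p)"
proof (rule ccontr)
  define D where "D = P * B powr (1 - p)"
  define d where "d = norm (f x) - D"
  assume "\<not> norm (f x) \<le> P * B powr (1 - p)"
  then have d: "d > 0" by (simp add: D_def d_def)
  have [measurable]: "f' \<in> borel_measurable borel"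
    using cont by (rule borel_measurable_continuous_onI)
  have split: "norm (f' y) \<le> norm (f' y) powr p * B powr (1 - p)" for y
  proof -
    have "norm (f' y) = norm (f' y) powr p * norm (f' y) powr (1 - p)"
      by (simp flip: powr_add)
    also have "\<dots> \<le> norm (f' y) powr p * B powr (1 - p)"
      using p B by (intro mult_left_mono powr_mono2) auto
    finally show ?thesis .
  qed
  have "(\<integral>\<^sup>+ y. ennreal (norm (f' y)) \<partial>lborel) \<le>
      (\<integral>\<^sup>+ y. ennreal (norm (f' y) powr p) * ennreal (B powr (1 - p)) \<partial>lborel)"
    using split by (intro nn_integral_mono) (simp add: ennreal_leI flip: ennreal_mult)
  also have "\<dots> = (\<integral>\<^sup>+ y. ennreal (norm (f' y) powr p) \<partial>lborel) * ennreal (B powr (1 - p))"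
    by (intro nn_integral_multc) measurable
  also have "\<dots> \<le> ennreal P * ennreal (B powr (1 - p))"
    using f' by (intro mult_right_mono) auto
  also have "\<dots> = ennreal D"
    using \<open>0 \<le> P\<close> by (simp add: D_def ennreal_mult)
  finally have int: "(\<integral>\<^sup>+ y. ennreal (norm (f' y)) \<partial>lborel) \<le> ennreal D" .
  have D0: "0 \<le> D" using \<open>0 \<le> P\<close> by (simp add: D_def)
  have "norm (f x - f y) \<le> D" for y
    using norm_diff_le_nn_integral[OF der cont int D0, of x y]
      norm_diff_le_nn_integral[OF der cont int D0, of y x]
    by (cases "x \<le> y") (auto simp: norm_minus_commute)
  \<comment> \<open>The increments of \<open>f\<close> are at most \<open>D\<close>, while
    \<open>norm (f x)\<close> exceeds \<open>D\<close> by \<open>d\<close>. So \<open>f\<close>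
    stays away from zero on the whole line, which makes the integral of its \<open>p\<close>-th
    power infinite.\<close>
  then have "d \<le> norm (f y)" for y
    using norm_triangle_ineq2[of "f x" "f y"] by (smt (verit) d_def)
  then have "(\<integral>\<^sup>+ y. ennreal (d powr p) \<partial>(lborel :: real measure)) \<le>
      (\<integral>\<^sup>+ y. ennreal (norm (f y) powr p) \<partial>lborel)"
    using p d by (intro nn_integral_mono ennreal_leI powr_mono2) auto
  then show False
    using f d by (simp add: ennreal_mult_top)
qed


section \<open>Growth of the derivatives\<close>

text \<open>Replaces the extended tolerances of the definitions by real ones; it serves the cases
  \<open>r = 0\<close> and \<open>r = 1\<close>.\<close>

lemma ennreal_less_realE:
  assumes "ennreal r < \<epsilon>" "0 \<le> r"
  obtains s where "r < s" "ennreal s < \<epsilon>"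
proof -
  obtain x where x: "ennreal r < x" "x < \<epsilon>"
    using assms dense by blast
  then show ?thesis
    using that[of "enn2real x"] assms(2) by (cases x) (auto simp: ennreal_less_iff)
qed

lemma tendsto_0_ennreal_iff:
  "(X \<longlongrightarrow> (0::ennreal)) F \<longleftrightarrow> (\<forall>e>0. \<forall>\<^sub>F n in F. X n \<le> ennreal e)"
proof
  assume X: "(X \<longlongrightarrow> 0) F"
  show "\<forall>e>0. \<forall>\<^sub>F n in F. X n \<le> ennreal e"
  proof (intro allI impI)
    fix e :: real
    assume "0 < e"
    then have "\<forall>\<^sub>F n in F. X n < ennreal e"
      using order_tendstoD(2)[OF X, of "ennreal e"] by simp
    then show "\<forall>\<^sub>F n in F. X n \<le> ennreal e"
      by eventually_elim simp
  qed
next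
  assume X: "\<forall>e>0. \<forall>\<^sub>F n in F. X n \<le> ennreal e"
  show "(X \<longlongrightarrow> 0) F"
  proof (rule order_tendstoI)
    fix \<epsilon> :: ennreal
    assume "0 < \<epsilon>"
    then obtain e where "0 < e" "ennreal e < \<epsilon>"
      using ennreal_less_realE[of 0 \<epsilon>] by auto
    then show "\<forall>\<^sub>F n in F. X n < \<epsilon>"
      using X by (auto elim!: eventually_mono)
  qed auto
qed

text \<open>The limsup condition of the class in terms of real, pointwise bounds. It takes an
  arbitrary sequence of functions, so that termwise sums and multiples of derivatives can be
  inserted directly.\<close>

definition slow_growth :: "real \<Rightarrow> (nat \<Rightarrow> real \<Rightarrow> 'a::real_normed_vector) \<Rightarrow> bool" where
  "slow_growth q F \<longleftrightarrow> (\<forall>d>0. \<forall>\<^sub>F k in sequentially. \<forall>x. norm (F k x) powr q ^ k \<le> 1 + d)"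

lemma limsup_le_1_iff_slow_growth:
  assumes "0 < q"
  shows "limsup (\<lambda>k. epow (sup_norm (F k)) (q ^ k)) \<le> 1 \<longleftrightarrow> slow_growth q F"
proof -
  have "limsup X \<le> 1 \<longleftrightarrow> (\<forall>d>0. \<forall>\<^sub>F k in sequentially. X k \<le> ennreal (1 + d))" for X
  proof
    assume X: "limsup X \<le> 1"
    show "\<forall>d>0. \<forall>\<^sub>F k in sequentially. X k \<le> ennreal (1 + d)"
    proof (intro allI impI)
      fix d :: real
      assume "0 < d"
      then have "1 < ennreal (1 + d)"
        by (simp add: ennreal_less_iff flip: ennreal_1)
      with X have "\<forall>\<^sub>F k in sequentially. X k < ennreal (1 + d)"
        by (simp add: Limsup_le_iff)
      then show "\<forall>\<^sub>F k in sequentially. X k \<le> ennreal (1 + d)"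
        by eventually_elim simp
    qed
  next
    assume X: "\<forall>d>0. \<forall>\<^sub>F k in sequentially. X k \<le> ennreal (1 + d)"
    show "limsup X \<le> 1"
      unfolding Limsup_le_iff
    proof (intro allI impI)
      fix y :: ennreal
      assume "1 < y"
      then obtain s where s: "1 < s" "ennreal s < y"
        using ennreal_less_realE[of 1 y] by auto
      have "\<forall>\<^sub>F k in sequentially. X k \<le> ennreal (1 + (s - 1))"
        using X s(1) by (metis diff_gt_0_iff_gt)
      then show "\<forall>\<^sub>F k in sequentially. X k < y"
        using s(2) by (auto elim!: eventually_mono)
    qed
  qed
  then show ?thesis
    using assms by (simp add: slow_growth_def epow_sup_norm_le_iff del: ennreal_plus)
qed

text \<open>The factor \<open>c\<close> is harmless because \<open>c powr q ^ k\<close> tends to 1.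
  A maximum is convenient since its power is bounded by whichever of the two bounds applies.\<close>

lemma slow_growth_dominated:
  assumes q: "0 < q" "q < 1" and F: "slow_growth q F" and G: "slow_growth q G" and "0 < c"
    and H: "\<And>k x. norm (H k x) \<le> c * max (norm (F k x)) (norm (G k x))"
  shows "slow_growth q H"
  unfolding slow_growth_def
proof (intro allI impI)
  fix d :: real
  assume d: "0 < d"
  \<comment> \<open>Half of the tolerance is spent on \<open>F\<close> and \<open>G\<close>; the
    other half absorbs the power of \<open>c\<close>.\<close>
  have "(\<lambda>k. c powr q ^ k * (1 + d / 2)) \<longlonglongrightarrow> c powr 0 * (1 + d / 2)"
    using q \<open>0 < c\<close> by (intro tendsto_intros LIMSEQ_realpow_zero) auto
  then have "\<forall>\<^sub>F k in sequentially. c powr q ^ k * (1 + d / 2) < 1 + d"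
    using d \<open>0 < c\<close> by (intro order_tendstoD(2)) auto
  moreover have "\<forall>\<^sub>F k in sequentially. \<forall>x. norm (F k x) powr q ^ k \<le> 1 + d / 2"
    "\<forall>\<^sub>F k in sequentially. \<forall>x. norm (G k x) powr q ^ k \<le> 1 + d / 2"
    using F G d by (auto simp: slow_growth_def)
  ultimately show "\<forall>\<^sub>F k in sequentially. \<forall>x. norm (H k x) powr q ^ k \<le> 1 + d"
  proof eventually_elim
    case (elim k)
    show ?case
    proof
      fix x
      have "norm (H k x) powr q ^ k \<le> (c * max (norm (F k x)) (norm (G k x))) powr q ^ k"
        using H q by (intro powr_mono2) auto
      also have "\<dots> = c powr q ^ k * max (norm (F k x)) (norm (G k x)) powr q ^ k"
        using \<open>0 < c\<close> by (simp add: powr_mult)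
      also have "\<dots> \<le> c powr q ^ k * (1 + d / 2)"
        using elim(2,3) by (intro mult_left_mono) (auto simp: max_def)
      also have "\<dots> \<le> 1 + d" using elim(1) by simp
      finally show "norm (H k x) powr q ^ k \<le> 1 + d" .
    qed
  qed
qed

section \<open>The class and its supremum bounds\<close>

text \<open>\<open>summable_ln_M\<close> is the logarithmic form of the convergence of the product,
  with the constant factor \<open>p / (1 - p)\<close> removed from the exponents.\<close>

locale weights =
  fixes p :: real and M :: "nat \<Rightarrow> real"
  assumes p: "0 < p" "p < 1" and M: "\<And>k. 1 \<le> M k"
    and summable_ln_M: "summable (\<lambda>k. (1 - p) ^ k * ln (M k))"
begin

abbreviation "S \<equiv> S_class p M"
abbreviation "N \<equiv> M_qnorm p M"

lemma M_pos: "0 < M k"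
  using M[of k] by simp

lemmas N_le_iff = M_qnorm_le_iff[OF p(1) _ M_pos]

lemma S_iff: "f \<in> S \<longleftrightarrow> f \<in> C_infinity \<and> N f < \<infinity> \<and> slow_growth (1 - p) (\<lambda>k. nderiv k f)"
  using p by (simp add: S_class_def limsup_le_1_iff_slow_growth)

lemma S_imp_C_infinity: "f \<in> S \<Longrightarrow> f \<in> C_infinity"
  by (simp add: S_iff)

lemma N_boundE:
  assumes "f \<in> S"
  obtains a where "0 \<le> a" "N f = ennreal a"
  using assms by (cases "N f") (auto simp: S_iff)

section \<open>Quasi-norm estimates and the vector space structure of the class\<close>

lemma measurable_nderiv [measurable (raw)]:
  "f \<in> C_infinity \<Longrightarrow> nderiv k f \<in> borel_measurable borel"
  by (intro borel_measurable_continuous_onI continuous_on_nderiv)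

text \<open>Integrals of \<open>p\<close>-th powers are subadditive, so the \<open>p\<close>-th
  powers of the bounds add. Real upper bounds \<open>a\<close> and \<open>b\<close> stand in for the
  quasi-norms, which keeps the arithmetic real.\<close>

lemma N_add:
  assumes f: "f \<in> C_infinity" and g: "g \<in> C_infinity"
    and a: "0 \<le> a" "N f \<le> ennreal a" and b: "0 \<le> b" "N g \<le> ennreal b"
  shows "N (\<lambda>x. f x + g x) \<le> ennreal ((a powr p + b powr p) powr (1 / p))"
  unfolding N_le_iff[OF powr_ge_zero] nderiv_add[OF f g]
proof
  fix k
  note [measurable] = measurable_nderiv[OF f] measurable_nderiv[OF g]
  have "(\<integral>\<^sup>+x. ennreal (norm (nderiv k f x + nderiv k g x) powr p) \<partial>lborel) \<le>
      (\<integral>\<^sup>+x. ennreal (norm (nderiv k f x) powr p) + ennreal (norm (nderiv k g x) powr p) \<partial>lborel)"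
  proof (intro nn_integral_mono)
    fix x
    have "norm (nderiv k f x + nderiv k g x) powr p \<le> (norm (nderiv k f x) + norm (nderiv k g x)) powr p"
      using p by (intro powr_mono2 norm_triangle_ineq) auto
    also have "\<dots> \<le> norm (nderiv k f x) powr p + norm (nderiv k g x) powr p"
      using p by (intro powr_add_le_add_powr) auto
    finally show "ennreal (norm (nderiv k f x + nderiv k g x) powr p) \<le>
        ennreal (norm (nderiv k f x) powr p) + ennreal (norm (nderiv k g x) powr p)"
      by (simp add: ennreal_leI flip: ennreal_plus)
  qed
  also have "\<dots> = (\<integral>\<^sup>+x. ennreal (norm (nderiv k f x) powr p) \<partial>lborel) +
      (\<integral>\<^sup>+x. ennreal (norm (nderiv k g x) powr p) \<partial>lborel)"
    by (intro nn_integral_add) measurable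
  also have "\<dots> \<le> ennreal ((a * M k) powr p) + ennreal ((b * M k) powr p)"
    using a b by (intro add_mono) (auto simp: N_le_iff)
  also have "\<dots> = ennreal (((a powr p + b powr p) powr (1 / p) * M k) powr p)"
    using a b p M_pos[of k] by (simp add: powr_mult powr_powr distrib_right flip: ennreal_plus)
  finally show "(\<integral>\<^sup>+x. ennreal (norm (nderiv k f x + nderiv k g x) powr p) \<partial>lborel) \<le>
      ennreal (((a powr p + b powr p) powr (1 / p) * M k) powr p)" .
qed

text \<open>The epsilon-halving argument for a quasi-norm: two \<open>p\<close>-th powers add, so
  each summand must be smaller by the factor \<open>2 powr (1 / p)\<close>.\<close>

lemma N_add_same:
  assumes "f \<in> C_infinity" "g \<in> C_infinity" and e: "0 < e"
    "N f \<le> ennreal (e / 2 powr (1 / p))" "N g \<le> ennreal (e / 2 powr (1 / p))"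
  shows "N (\<lambda>x. f x + g x) \<le> ennreal e"
proof -
  have "((e / 2 powr (1 / p)) powr p + (e / 2 powr (1 / p)) powr p) powr (1 / p) = e"
    using e(1) p by (simp add: powr_divide powr_powr)
  then show ?thesis
    using N_add[OF assms(1,2) _ e(2) _ e(3)] e(1) by simp
qed

lemma N_scale:
  fixes c :: "'a::real_normed_field"
  assumes f: "f \<in> C_infinity" and a: "0 \<le> a" "N f \<le> ennreal a"
  shows "N (\<lambda>x. c * f x) \<le> ennreal (norm c * a)"
proof -
  have "(\<integral>\<^sup>+x. ennreal (norm (c * nderiv k f x) powr p) \<partial>lborel) \<le> ennreal ((norm c * a * M k) powr p)" for k
  proof -
    note [measurable] = measurable_nderiv[OF f]
    have "(\<integral>\<^sup>+x. ennreal (norm (c * nderiv k f x) powr p) \<partial>lborel) =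
        (\<integral>\<^sup>+x. ennreal (norm c powr p) * ennreal (norm (nderiv k f x) powr p) \<partial>lborel)"
      by (intro nn_integral_cong) (simp add: norm_mult powr_mult ennreal_mult)
    also have "\<dots> = ennreal (norm c powr p) * (\<integral>\<^sup>+x. ennreal (norm (nderiv k f x) powr p) \<partial>lborel)"
      by (intro nn_integral_cmult) measurable
    also have "\<dots> \<le> ennreal (norm c powr p) * ennreal ((a * M k) powr p)"
      using a by (intro mult_left_mono) (auto simp: N_le_iff)
    also have "\<dots> = ennreal ((norm c * a * M k) powr p)"
      using a M_pos[of k] by (simp add: powr_mult mult.assoc flip: ennreal_mult)
    finally show ?thesis .
  qed
  then show ?thesis
    using a by (simp add: N_le_iff nderiv_scale[OF f])
qed

lemma S_add:
  assumes "f \<in> S" "g \<in> S"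
  shows "(\<lambda>x. f x + g x) \<in> S"
proof -
  note C = assms[THEN S_imp_C_infinity]
  obtain a b where "0 \<le> a" "N f = ennreal a" "0 \<le> b" "N g = ennreal b"
    using assms N_boundE by metis
  then have "N (\<lambda>x. f x + g x) < \<infinity>"
    using N_add[OF C, of a b] by (auto intro: le_less_trans)
  moreover have "slow_growth (1 - p) (\<lambda>k x. nderiv k f x + nderiv k g x)"
  proof (rule slow_growth_dominated)
    show "norm (nderiv k f x + nderiv k g x) \<le> 2 * max (norm (nderiv k f x)) (norm (nderiv k g x))" for k x
      by (rule norm_triangle_le) simp
  qed (use assms p in \<open>auto simp: S_iff\<close>)
  ultimately show ?thesis
    using C by (simp add: S_iff nderiv_add C_infinity_add)
qed

lemma S_scale:
  fixes c :: "'a::real_normed_field"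
  assumes "f \<in> S"
  shows "(\<lambda>x. c * f x) \<in> S"
proof -
  note C = S_imp_C_infinity[OF assms]
  obtain a where "0 \<le> a" "N f = ennreal a"
    using assms N_boundE by metis
  then have "N (\<lambda>x. c * f x) < \<infinity>"
    using N_scale[OF C, of a c] by (auto intro: le_less_trans)
  moreover have "slow_growth (1 - p) (\<lambda>k x. c * nderiv k f x)"
  proof (rule slow_growth_dominated)
    \<comment> \<open>The added 1 keeps the dominating constant positive when
      \<open>c = 0\<close>.\<close>
    show "norm (c * nderiv k f x) \<le> (norm c + 1) * max (norm (nderiv k f x)) (norm (nderiv k f x))" for k x
      by (simp add: norm_mult distrib_right)
  qed (use assms p in \<open>auto simp: S_iff add_nonneg_pos\<close>)
  ultimately show ?thesis
    using C by (simp add: S_iff nderiv_scale C_infinity_scale)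
qed

text \<open>The weight bounding the supremum of the \<open>k\<close>-th derivative: the infinite product
  \<open>M\<^bsub>k+1\<^esub>\<^bsup>p\<^esup> M\<^bsub>k+2\<^esub>\<^bsup>pq\<^esup> M\<^bsub>k+3\<^esub>\<^bsup>pqq\<^esup> \<dots>\<close> with \<open>q = 1 - p\<close>.\<close>

definition C :: "nat \<Rightarrow> real" where
  "C k = exp (\<Sum>j. p * (1 - p) ^ j * ln (M (k + j + 1)))"

lemma C_pos: "0 < C k"
  by (simp add: C_def)

text \<open>Since every \<open>M\<close> is at least 1, the logarithms are nonnegative and each
  partial sum lies below the series in \<open>C k\<close>.\<close>

lemma prod_le_C: "(\<Prod>j<n. M (k + j + 1) powr (p * (1 - p) ^ j)) \<le> C k"
proof -
  have "summable (\<lambda>j. (1 - p) ^ (j + (k + 1)) * ln (M (j + (k + 1))))"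
    using summable_ln_M
    by (rule summable_iff_shift[of "\<lambda>k. (1 - p) ^ k * ln (M k)" "k + 1", THEN iffD2])
  \<comment> \<open>This factor turns the tail of the assumed series into the weights that occur in
    \<open>C k\<close>.\<close>
  then have "summable (\<lambda>j. p / (1 - p) ^ (k + 1) * ((1 - p) ^ (j + (k + 1)) * ln (M (j + (k + 1)))))"
    by (rule summable_mult)
  also have "(\<lambda>j. p / (1 - p) ^ (k + 1) * ((1 - p) ^ (j + (k + 1)) * ln (M (j + (k + 1))))) =
      (\<lambda>j. p * (1 - p) ^ j * ln (M (k + j + 1)))"
  proof
    fix j
    have "p / q ^ (k + 1) * (q ^ (j + (k + 1)) * L) = p * q ^ j * L" if "0 < q" for q L :: real
      using that by (simp add: power_add field_simps)
    from this[of "1 - p"] show "p / (1 - p) ^ (k + 1) * ((1 - p) ^ (j + (k + 1)) * ln (M (j + (k + 1)))) =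
        p * (1 - p) ^ j * ln (M (k + j + 1))"
      using p by (simp only: add.commute[of k j] add.assoc)
  qed
  finally have "(\<Sum>j<n. p * (1 - p) ^ j * ln (M (k + j + 1))) \<le> (\<Sum>j. p * (1 - p) ^ j * ln (M (k + j + 1)))"
    using p M by (intro sum_le_suminf) (auto simp: ln_ge_zero)
  moreover have "M (k + j + 1) powr (p * (1 - p) ^ j) = exp (p * (1 - p) ^ j * ln (M (k + j + 1)))" for j
    using M_pos[of "k + j + 1"] by (simp add: powr_def)
  ultimately show ?thesis
    by (simp add: C_def flip: exp_sum)
qed

text \<open>The induction peels off the highest derivative: \<open>sup_bound_step\<close> converts a
  bound for order \<open>k + n + 1\<close> into one for order \<open>k + n\<close>, which is fed to
  the induction hypothesis. Hence \<open>B\<close> must be arbitrary.\<close>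

lemma sup_bound_iterate:
  fixes f :: "real \<Rightarrow> 'a::euclidean_space"
  assumes f: "f \<in> C_infinity" and a: "0 \<le> a" "N f \<le> ennreal a"
    and "\<And>x. norm (nderiv (k + n) f x) \<le> B"
  shows "norm (nderiv k f x) \<le> (\<Prod>j<n. (a * M (k + j + 1)) powr (p * (1 - p) ^ j)) * B powr (1 - p) ^ n"
  using assms(4)
proof (induction n arbitrary: B)
  case 0
  \<comment> \<open>Nonnegativity is what gives \<open>B powr 1 = B\<close>.\<close>
  then have "0 \<le> B"
    using norm_ge_zero order_trans by (metis (mono_tags))
  then show ?case using 0 by simp
next
  case (Suc n)
  define P where "P = (a * M (k + n + 1)) powr p"
  have I: "(\<integral>\<^sup>+x. ennreal (norm (nderiv j f x) powr p) \<partial>lborel) \<le> ennreal ((a * M j) powr p)" for j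
    using a by (simp add: N_le_iff)
  have "norm (nderiv (k + n) f y) \<le> P * B powr (1 - p)" for y
  proof (rule sup_bound_step[OF p])
    show "(nderiv (k + n) f has_vector_derivative nderiv (k + Suc n) f x) (at x)" for x
      using nderiv_has_vector_derivative[OF f] by simp
    show "(\<integral>\<^sup>+x. ennreal (norm (nderiv (k + n) f x) powr p) \<partial>lborel) < \<infinity>"
      using I[of "k + n"] by (auto intro: le_less_trans)
    show "(\<integral>\<^sup>+x. ennreal (norm (nderiv (k + Suc n) f x) powr p) \<partial>lborel) \<le> ennreal P"
      using I[of "k + Suc n"] by (simp add: P_def)
  qed (use Suc.prems continuous_on_nderiv[OF f] in \<open>auto simp: P_def\<close>)
  from Suc.IH[OF this] show ?case
    using p by (simp add: P_def powr_mult powr_powr mult_ac)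
qed

text \<open>\<open>sup_bound_iterate\<close> starts from the slow growth bound for order
  \<open>k + n\<close> with tolerance \<open>d\<close>. First \<open>n\<close> tends to infinity,
  then \<open>d\<close> tends to 0.\<close>

lemma sup_bound_pos:
  fixes f :: "real \<Rightarrow> 'a::euclidean_space"
  assumes f: "f \<in> S" and a: "0 < a" "N f \<le> ennreal a"
  shows "norm (nderiv k f x) \<le> C k * a"
proof -
  define q where "q = 1 - p"
  have q: "0 < q" "q < 1" using p by (auto simp: q_def)
  \<comment> \<open>The total exponent of \<open>a\<close> after \<open>n\<close> steps; it tends to
    1, which makes the final bound linear in \<open>a\<close>.\<close>
  have geo: "(\<Sum>j<n. p * q ^ j) = 1 - q ^ n" for n
    by (induction n) (auto simp: q_def algebra_simps)
  have *: "norm (nderiv k f x) \<le> a * C k * (1 + d) powr (1 / q ^ k)" if "0 < d" for d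
  proof (rule tendsto_lowerbound)
    show "(\<lambda>n. a powr (1 - q ^ n) * C k * (1 + d) powr (1 / q ^ k)) \<longlonglongrightarrow> a * C k * (1 + d) powr (1 / q ^ k)"
    proof -
      have "(\<lambda>n. a powr (1 - q ^ n) * C k * (1 + d) powr (1 / q ^ k)) \<longlonglongrightarrow>
          a powr (1 - 0) * C k * (1 + d) powr (1 / q ^ k)"
        using a q by (intro tendsto_intros LIMSEQ_realpow_zero) auto
      then show ?thesis using a by simp
    qed
    have "\<forall>\<^sub>F n in sequentially. \<forall>x. norm (nderiv n f x) powr q ^ n \<le> 1 + d"
      using f that by (auto simp: S_iff slow_growth_def q_def)
    then have "\<forall>\<^sub>F n in sequentially. \<forall>x. norm (nderiv (n + k) f x) powr q ^ (n + k) \<le> 1 + d"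
      by (subst eventually_sequentially_seg)
    then show "\<forall>\<^sub>F n in sequentially. norm (nderiv k f x) \<le> a powr (1 - q ^ n) * C k * (1 + d) powr (1 / q ^ k)"
    proof eventually_elim
      case (elim n)
      then have "norm (nderiv (k + n) f y) \<le> (1 + d) powr (1 / q ^ (k + n))" for y
        using that q by (simp add: powr_le_iff add.commute)
      \<comment> \<open>The outer power \<open>q ^ n\<close> cancels against
        \<open>1 / q ^ (k + n)\<close>, so the factor containing \<open>d\<close> no longer depends
        on \<open>n\<close>.\<close>
      then have "norm (nderiv k f x) \<le> (\<Prod>j<n. (a * M (k + j + 1)) powr (p * q ^ j)) *
          ((1 + d) powr (1 / q ^ (k + n))) powr q ^ n"
        using sup_bound_iterate[of f a k n] f a by (simp add: q_def S_iff)
      also have "\<dots> = a powr (\<Sum>j<n. p * q ^ j) * (\<Prod>j<n. M (k + j + 1) powr (p * q ^ j)) *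
          (1 + d) powr (1 / q ^ k)"
        using a q by (simp add: powr_mult prod.distrib powr_sum powr_powr power_add)
      also have "\<dots> \<le> a powr (1 - q ^ n) * C k * (1 + d) powr (1 / q ^ k)"
        unfolding geo using prod_le_C[where n = n and k = k] a
        by (intro mult_left_mono mult_right_mono) (auto simp: q_def)
      finally show ?case .
    qed
  qed simp
  have "norm (nderiv k f x) \<le> a * C k * (1 + 0) powr (1 / q ^ k)"
  proof (rule tendsto_lowerbound)
    show "((\<lambda>d. a * C k * (1 + d) powr (1 / q ^ k)) \<longlongrightarrow> a * C k * (1 + 0) powr (1 / q ^ k)) (at_right 0)"
      by (intro tendsto_intros) auto
    show "\<forall>\<^sub>F d in at_right 0. norm (nderiv k f x) \<le> a * C k * (1 + d) powr (1 / q ^ k)"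
      using * by (simp add: eventually_at_right_less eventually_at_filter)
  qed simp
  then show ?thesis by (simp add: mult.commute)
qed

text \<open>Includes \<open>a = 0\<close> by applying the positive case to the slightly larger bound
  \<open>a + e / C k\<close>.\<close>

lemma sup_bound:
  fixes f :: "real \<Rightarrow> 'a::euclidean_space"
  assumes f: "f \<in> S" and a: "0 \<le> a" "N f \<le> ennreal a"
  shows "norm (nderiv k f x) \<le> C k * a"
proof (rule field_le_epsilon)
  fix e :: real
  assume e: "0 < e"
  have "norm (nderiv k f x) \<le> C k * (a + e / C k)"
    using a e C_pos[of k]
    by (intro sup_bound_pos f order_trans[OF a(2)]) (auto intro!: ennreal_leI add_nonneg_pos)
  then show "norm (nderiv k f x) \<le> C k * a + e"
    using C_pos[of k] by (simp add: distrib_left)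
qed

section \<open>The completion\<close>

abbreviation "SC \<equiv> S_Cauchy p M"

lemma S_diff:
  fixes f g :: "real \<Rightarrow> 'a::real_normed_field"
  assumes "f \<in> S" "g \<in> S"
  shows "(\<lambda>x. f x - g x) \<in> S"
  using S_add[OF assms(1) S_scale[OF assms(2), of "-1"]] by simp

lemma
  fixes f g :: "real \<Rightarrow> 'a::real_normed_field"
  assumes "f \<in> C_infinity" "g \<in> C_infinity"
  shows C_infinity_diff: "(\<lambda>x. f x - g x) \<in> C_infinity"
    and nderiv_diff: "nderiv k (\<lambda>x. f x - g x) = (\<lambda>x. nderiv k f x - nderiv k g x)"
  using C_infinity_add[OF assms(1) C_infinity_scale[OF assms(2), of "-1"]]
    nderiv_add[OF assms(1) C_infinity_scale[OF assms(2), of "-1"], of k]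
    nderiv_scale[OF assms(2), of k "-1"]
  by simp_all

text \<open>Exchanges strict inequalities with extended tolerances for weak ones with real
  tolerances, the form in which \<open>N_le_iff\<close> and \<open>N_add_same\<close> apply.\<close>

lemma SC_iff:
  "u \<in> SC \<longleftrightarrow> (\<forall>n. u n \<in> S) \<and>
    (\<forall>e>0. \<exists>n0. \<forall>m\<ge>n0. \<forall>n\<ge>n0. N (\<lambda>x. u m x - u n x) \<le> ennreal e)"
proof -
  have "(\<forall>\<epsilon>>0. \<exists>n0. \<forall>m\<ge>n0. \<forall>n\<ge>n0. X m n < \<epsilon>) \<longleftrightarrow>
      (\<forall>e>0. \<exists>n0. \<forall>m\<ge>n0. \<forall>n\<ge>n0. X m n \<le> ennreal e)" (is "?L \<longleftrightarrow> ?R")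
    for X :: "nat \<Rightarrow> nat \<Rightarrow> ennreal"
  proof
    assume ?L
    show ?R
    proof (intro allI impI)
      fix e :: real
      assume "0 < e"
      then obtain n0 where "\<forall>m\<ge>n0. \<forall>n\<ge>n0. X m n < ennreal e"
        using \<open>?L\<close>[rule_format, of "ennreal e"] by auto
      then show "\<exists>n0. \<forall>m\<ge>n0. \<forall>n\<ge>n0. X m n \<le> ennreal e"
        by (meson less_imp_le)
    qed
  next
    assume ?R
    show ?L
    proof (intro allI impI)
      fix \<epsilon> :: ennreal
      assume "0 < \<epsilon>"
      then obtain e where e: "0 < e" "ennreal e < \<epsilon>"
        using ennreal_less_realE[of 0 \<epsilon>] by auto
      with \<open>?R\<close> obtain n0 where "\<forall>m\<ge>n0. \<forall>n\<ge>n0. X m n \<le> ennreal e"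
        by blast
      then show "\<exists>n0. \<forall>m\<ge>n0. \<forall>n\<ge>n0. X m n < \<epsilon>"
        using e(2) by (meson le_less_trans)
    qed
  qed
  then show ?thesis
    by (simp add: S_Cauchy_def)
qed

lemma SC_imp_S: "u \<in> SC \<Longrightarrow> u n \<in> S"
  by (simp add: SC_iff)

lemma SC_imp_C_infinity: "u \<in> SC \<Longrightarrow> u n \<in> C_infinity"
  by (simp add: SC_iff S_imp_C_infinity)

lemma SC_D:
  assumes "u \<in> SC" "0 < e"
  shows "\<exists>n0. \<forall>m\<ge>n0. \<forall>n\<ge>n0. N (\<lambda>x. u m x - u n x) \<le> ennreal e"
  using assms(1)[unfolded SC_iff, THEN conjunct2, rule_format, OF assms(2)] .

lemma N_0: "N (\<lambda>x. (0 :: 'a::real_normed_field)) = 0"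
proof -
  have "(\<lambda>x. (0 :: 'a)) \<in> C_infinity"
    using C_infinityI[where g = "\<lambda>k x. (0 :: 'a)"] by auto
  moreover have "nderiv k (\<lambda>x. (0 :: 'a)) = (\<lambda>x. 0)" for k
    using nderiv_eqI[where g = "\<lambda>k x. (0 :: 'a)" and k = k] by auto
  ultimately have "N (\<lambda>x. (0 :: 'a)) \<le> ennreal 0"
    using N_le_iff[where c = 0 and f = "\<lambda>x. (0 :: 'a)"] by simp
  then show ?thesis by simp
qed

lemma SC_const:
  fixes f :: "real \<Rightarrow> 'a::real_normed_field"
  assumes "f \<in> S"
  shows "(\<lambda>n. f) \<in> SC"
  using assms by (simp add: SC_iff N_0)

lemma SC_add:
  fixes u v :: "nat \<Rightarrow> real \<Rightarrow> 'a::real_normed_field"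
  assumes "u \<in> SC" "v \<in> SC"
  shows "(\<lambda>n x. u n x + v n x) \<in> SC"
  unfolding SC_iff
proof (intro conjI allI impI)
  fix e :: real
  assume "0 < e"
  then have e: "0 < e / 2 powr (1 / p)" by simp
  obtain n1 where n1 [rule_format]: "\<forall>m\<ge>n1. \<forall>n\<ge>n1. N (\<lambda>x. u m x - u n x) \<le> ennreal (e / 2 powr (1 / p))"
    by (rule exE[OF SC_D[OF assms(1) e]])
  obtain n2 where n2 [rule_format]: "\<forall>m\<ge>n2. \<forall>n\<ge>n2. N (\<lambda>x. v m x - v n x) \<le> ennreal (e / 2 powr (1 / p))"
    by (rule exE[OF SC_D[OF assms(2) e]])
  have "N (\<lambda>x. (u m x - u n x) + (v m x - v n x)) \<le> ennreal e" if "max n1 n2 \<le> m" "max n1 n2 \<le> n" for m n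
    using that assms n1[of m n] n2[of m n] \<open>0 < e\<close>
    by (intro N_add_same C_infinity_diff SC_imp_C_infinity) auto
  then show "\<exists>n0. \<forall>m\<ge>n0. \<forall>n\<ge>n0. N (\<lambda>x. u m x + v m x - (u n x + v n x)) \<le> ennreal e"
    by (intro exI[of _ "max n1 n2"]) (simp add: algebra_simps)
qed (use assms in \<open>auto intro: S_add SC_imp_S\<close>)

lemma SC_scale:
  fixes u :: "nat \<Rightarrow> real \<Rightarrow> 'a::real_normed_field"
  assumes "u \<in> SC"
  shows "(\<lambda>n x. c * u n x) \<in> SC"
  unfolding SC_iff
proof (intro conjI allI impI)
  fix e :: real
  assume e: "0 < e"
  \<comment> \<open>Adding 1 avoids division by zero for \<open>c = 0\<close>.\<close>
  define r where "r = e / (norm c + 1)"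
  have "0 < norm c + 1" by (simp add: add_nonneg_pos)
  then have r: "0 < r" "norm c * r \<le> e"
    using e by (auto simp: r_def field_simps)
  obtain n0 where n0 [rule_format]: "\<forall>m\<ge>n0. \<forall>n\<ge>n0. N (\<lambda>x. u m x - u n x) \<le> ennreal r"
    by (rule exE[OF SC_D[OF assms r(1)]])
  have "N (\<lambda>x. c * (u m x - u n x)) \<le> ennreal e" if "n0 \<le> m" "n0 \<le> n" for m n
    using N_scale[OF C_infinity_diff[OF SC_imp_C_infinity[OF assms, of m] SC_imp_C_infinity[OF assms, of n]] _ n0[OF that], of c] r
    by (auto elim!: order_trans intro: ennreal_leI)
  then show "\<exists>n0. \<forall>m\<ge>n0. \<forall>n\<ge>n0. N (\<lambda>x. c * u m x - c * u n x) \<le> ennreal e"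
    by (auto simp: right_diff_distrib)
qed (use assms in \<open>auto intro: S_scale SC_imp_S\<close>)

lemma SC_diff:
  fixes u v :: "nat \<Rightarrow> real \<Rightarrow> 'a::real_normed_field"
  assumes "u \<in> SC" "v \<in> SC"
  shows "(\<lambda>n x. u n x - v n x) \<in> SC"
  using SC_add[OF assms(1) SC_scale[OF assms(2), of "-1"]] by simp

section \<open>Limits of Cauchy sequences\<close>

definition S_lim :: "(nat \<Rightarrow> real \<Rightarrow> 'a::real_normed_vector) \<Rightarrow> real \<Rightarrow> 'a" where
  "S_lim u x = lim (\<lambda>n. u n x)"

text \<open>Differences of members stay in the class, so \<open>sup_bound\<close> turns the Cauchy
  condition for the quasi-norm into a uniform one for each derivative.\<close>

lemma SC_uniformly_convergent:
  fixes u :: "nat \<Rightarrow> real \<Rightarrow> 'a::{real_normed_field, euclidean_space}"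
  assumes u: "u \<in> SC"
  shows "uniformly_convergent_on UNIV (\<lambda>n. nderiv k (u n))"
proof (intro Cauchy_uniformly_convergent uniformly_Cauchy_onI)
  fix e :: real
  assume e: "0 < e"
  \<comment> \<open>The factor 2 makes room for a strict inequality at the end.\<close>
  then have eC: "0 < e / (2 * C k)" using C_pos[of k] by simp
  obtain n0 where n0 [rule_format]: "\<forall>m\<ge>n0. \<forall>n\<ge>n0. N (\<lambda>x. u m x - u n x) \<le> ennreal (e / (2 * C k))"
    by (rule exE[OF SC_D[OF u eC]])
  have "dist (nderiv k (u m) x) (nderiv k (u n) x) < e" if "n0 \<le> m" "n0 \<le> n" for x m n
  proof -
    have "norm (nderiv k (\<lambda>x. u m x - u n x) x) \<le> C k * (e / (2 * C k))"
      using u e C_pos[of k] n0[OF that] by (intro sup_bound S_diff SC_imp_S) auto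
    also have "\<dots> < e" using e C_pos[of k] by simp
    finally show ?thesis
      using u by (simp add: nderiv_diff SC_imp_C_infinity dist_norm)
  qed
  then show "\<exists>M. \<forall>x\<in>UNIV. \<forall>m\<ge>M. \<forall>n\<ge>M. dist (nderiv k (u m) x) (nderiv k (u n) x) < e"
    by blast
qed

text \<open>The uniform limits of the derivatives of successive orders form a tower of derivatives;
  smoothness and the identification of each limit follow together.\<close>

lemma
  fixes u :: "nat \<Rightarrow> real \<Rightarrow> 'a::{real_normed_field, euclidean_space}"
  assumes u: "u \<in> SC"
  shows S_lim_C_infinity: "S_lim u \<in> C_infinity"
    and S_lim_uniform_limit: "uniform_limit UNIV (\<lambda>n. nderiv k (u n)) (nderiv k (S_lim u)) sequentially"
proof -
  define g where "g = (\<lambda>k x. lim (\<lambda>n. nderiv k (u n) x))"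
  have lim: "uniform_limit UNIV (\<lambda>n. nderiv k (u n)) (g k) sequentially" for k
    using SC_uniformly_convergent[OF u]
    by (simp add: g_def uniformly_convergent_uniform_limit_iff)
  have g: "(g k has_vector_derivative g (Suc k) x) (at x)" for k x
    using nderiv_has_vector_derivative[OF SC_imp_C_infinity[OF u]] tendsto_uniform_limitI[OF lim] lim
    by (rule uniform_limit_vector_derivative) auto
  have "g 0 = S_lim u"
    by (simp add: g_def S_lim_def fun_eq_iff)
  then show "S_lim u \<in> C_infinity"
    "uniform_limit UNIV (\<lambda>n. nderiv k (u n)) (nderiv k (S_lim u)) sequentially"
    using C_infinityI[where g = g, OF g] nderiv_eqI[where g = g, OF g] lim by metis+
qed

lemma S_lim_nderiv_tendsto:
  fixes u :: "nat \<Rightarrow> real \<Rightarrow> 'a::{real_normed_field, euclidean_space}"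
  assumes "u \<in> SC"
  shows "(\<lambda>n. nderiv k (u n) x) \<longlonglongrightarrow> nderiv k (S_lim u) x"
  using tendsto_uniform_limitI[OF S_lim_uniform_limit[OF assms]] by auto

lemma S_lim_tendsto:
  fixes u :: "nat \<Rightarrow> real \<Rightarrow> 'a::{real_normed_field, euclidean_space}"
  assumes "u \<in> SC"
  shows "(\<lambda>n. u n x) \<longlonglongrightarrow> S_lim u x"
  using S_lim_nderiv_tendsto[OF assms, of 0] by simp

lemma S_limI:
  fixes u :: "nat \<Rightarrow> real \<Rightarrow> 'a::real_normed_vector"
  assumes "\<And>x. (\<lambda>n. u n x) \<longlonglongrightarrow> f x"
  shows "S_lim u = f"
  using assms by (auto simp: S_lim_def limI)

lemma
  fixes u v :: "nat \<Rightarrow> real \<Rightarrow> 'a::{real_normed_field, euclidean_space}"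
  assumes "u \<in> SC" "v \<in> SC"
  shows S_lim_add: "S_lim (\<lambda>n x. u n x + v n x) = (\<lambda>x. S_lim u x + S_lim v x)"
    and S_lim_diff: "S_lim (\<lambda>n x. u n x - v n x) = (\<lambda>x. S_lim u x - S_lim v x)"
  by (intro S_limI tendsto_intros S_lim_tendsto assms)+

lemma S_lim_scale:
  fixes u :: "nat \<Rightarrow> real \<Rightarrow> 'a::{real_normed_field, euclidean_space}"
  assumes "u \<in> SC"
  shows "S_lim (\<lambda>n x. c * u n x) = (\<lambda>x. c * S_lim u x)"
  by (intro S_limI tendsto_intros S_lim_tendsto assms)

text \<open>Fatou's lemma in the second index \<open>m\<close>, with \<open>n\<close> fixed: the
  bound on the integrals for \<open>u n - u m\<close> survives the pointwise limit. The limit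
  function enters only through smoothness and pointwise convergence of derivatives.\<close>

lemma N_diff_S_lim:
  fixes u :: "nat \<Rightarrow> real \<Rightarrow> 'a::{real_normed_field, euclidean_space}"
  assumes u: "u \<in> SC" and e: "0 < e"
  shows "\<forall>\<^sub>F n in sequentially. N (\<lambda>x. u n x - S_lim u x) \<le> ennreal e"
proof -
  obtain n0 where n0 [rule_format]: "\<forall>m\<ge>n0. \<forall>n\<ge>n0. N (\<lambda>x. u m x - u n x) \<le> ennreal e"
    by (rule exE[OF SC_D[OF u e]])
  have "N (\<lambda>x. u n x - S_lim u x) \<le> ennreal e" if n: "n0 \<le> n" for n
    unfolding N_le_iff[OF less_imp_le[OF e]]
  proof
    fix k
    note D = nderiv_diff[OF SC_imp_C_infinity[OF u] S_lim_C_infinity[OF u]]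
    note D' = nderiv_diff[OF SC_imp_C_infinity[OF u] SC_imp_C_infinity[OF u]]
    note [measurable] = measurable_nderiv[OF SC_imp_C_infinity[OF u]]
    have "(\<integral>\<^sup>+x. ennreal (norm (nderiv k (\<lambda>x. u n x - S_lim u x) x) powr p) \<partial>lborel) =
        (\<integral>\<^sup>+x. liminf (\<lambda>m. ennreal (norm (nderiv k (u n) x - nderiv k (u m) x) powr p)) \<partial>lborel)"
    proof (intro nn_integral_cong)
      fix x
      have "(\<lambda>m. norm (nderiv k (u n) x - nderiv k (u m) x) powr p) \<longlonglongrightarrow>
          norm (nderiv k (u n) x - nderiv k (S_lim u) x) powr p"
        using p by (intro tendsto_powr' tendsto_intros S_lim_nderiv_tendsto u) auto
      then have "(\<lambda>m. ennreal (norm (nderiv k (u n) x - nderiv k (u m) x) powr p)) \<longlonglongrightarrow>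
          ennreal (norm (nderiv k (u n) x - nderiv k (S_lim u) x) powr p)"
        by (rule tendsto_ennrealI)
      from lim_imp_Liminf[OF _ this, symmetric] show "ennreal (norm (nderiv k (\<lambda>x. u n x - S_lim u x) x) powr p) =
          liminf (\<lambda>m. ennreal (norm (nderiv k (u n) x - nderiv k (u m) x) powr p))"
        by (simp add: D)
    qed
    also have "\<dots> \<le> liminf (\<lambda>m. \<integral>\<^sup>+x. ennreal (norm (nderiv k (u n) x - nderiv k (u m) x) powr p) \<partial>lborel)"
      by (intro nn_integral_liminf) measurable
    also have "\<dots> \<le> liminf (\<lambda>m. ennreal ((e * M k) powr p))"
    proof (rule Liminf_mono)
      show "\<forall>\<^sub>F m in sequentially. (\<integral>\<^sup>+x. ennreal (norm (nderiv k (u n) x - nderiv k (u m) x) powr p) \<partial>lborel)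
          \<le> ennreal ((e * M k) powr p)"
        using eventually_ge_at_top[of n0]
      proof eventually_elim
        case (elim m)
        show ?case
          using n0[OF n elim] e by (simp add: N_le_iff D')
      qed
    qed
    also have "\<dots> = ennreal ((e * M k) powr p)"
      by (simp add: Liminf_const)
    finally show "(\<integral>\<^sup>+x. ennreal (norm (nderiv k (\<lambda>x. u n x - S_lim u x) x) powr p) \<partial>lborel)
        \<le> ennreal ((e * M k) powr p)" .
  qed
  then show ?thesis
    by (auto simp: eventually_sequentially)
qed

text \<open>From left to right, \<open>sup_bound\<close> at order 0 forces the limits to agree.
  Conversely, both sequences approach the common limit in the quasi-norm by
  \<open>N_diff_S_lim\<close>. Injectivity and independence of representatives rest on this.\<close>

lemma S_rel_iff:
  fixes u v :: "nat \<Rightarrow> real \<Rightarrow> 'a::{real_normed_field, euclidean_space}"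
  shows "(u, v) \<in> S_rel p M \<longleftrightarrow> u \<in> SC \<and> v \<in> SC \<and> S_lim u = S_lim v"
proof -
  have "(\<lambda>n. N (\<lambda>x. u n x - v n x)) \<longlonglongrightarrow> 0 \<longleftrightarrow> S_lim u = S_lim v" if u: "u \<in> SC" and v: "v \<in> SC"
  proof
    assume "(\<lambda>n. N (\<lambda>x. u n x - v n x)) \<longlonglongrightarrow> 0"
    then have ev: "\<forall>\<^sub>F n in sequentially. N (\<lambda>x. u n x - v n x) \<le> ennreal e" if "0 < e" for e
      using that by (simp add: tendsto_0_ennreal_iff)
    show "S_lim u = S_lim v"
    proof
      fix x
      have "norm (S_lim u x - S_lim v x) \<le> 0 + e" if "0 < e" for e
      proof (rule tendsto_upperbound)
        show "(\<lambda>n. norm (u n x - v n x)) \<longlonglongrightarrow> norm (S_lim u x - S_lim v x)"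
          by (intro tendsto_intros S_lim_tendsto u v)
        have "0 < e / C 0" using that C_pos[of 0] by simp
        from ev[OF this] show "\<forall>\<^sub>F n in sequentially. norm (u n x - v n x) \<le> 0 + e"
        proof eventually_elim
          case (elim n)
          then show ?case
            using sup_bound[OF S_diff[OF SC_imp_S[OF u, of n] SC_imp_S[OF v, of n]] _ elim, of 0 x] that C_pos[of 0]
            by simp
        qed
      qed simp
      then have "norm (S_lim u x - S_lim v x) \<le> 0"
        by (rule field_le_epsilon)
      then show "S_lim u x = S_lim v x" by simp
    qed
  next
    assume eq: "S_lim u = S_lim v"
    show "(\<lambda>n. N (\<lambda>x. u n x - v n x)) \<longlonglongrightarrow> 0"
      unfolding tendsto_0_ennreal_iff
    proof (intro allI impI)
      fix e :: real
      assume e: "0 < e"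
      then have "0 < e / 2 powr (1 / p)" by simp
      from N_diff_S_lim[OF u this] N_diff_S_lim[OF v this]
      show "\<forall>\<^sub>F n in sequentially. N (\<lambda>x. u n x - v n x) \<le> ennreal e"
      proof eventually_elim
        case (elim n)
        note Cu = C_infinity_diff[OF SC_imp_C_infinity[OF u, of n] S_lim_C_infinity[OF u]]
        note Cv = C_infinity_diff[OF SC_imp_C_infinity[OF v, of n] S_lim_C_infinity[OF v]]
        \<comment> \<open>The common limit is inserted, and the difference is written as a sum so
          that \<open>N_add_same\<close> applies.\<close>
        have "N (\<lambda>x. (u n x - S_lim u x) + (- 1) * (v n x - S_lim v x)) \<le> ennreal e"
          using elim N_scale[OF Cv _ elim(2), of "-1"] e
          by (intro N_add_same Cu C_infinity_scale Cv) auto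
        then show ?case
          by (simp add: eq)
      qed
    qed
  qed
  then show ?thesis
    by (auto simp: S_rel_def)
qed

text \<open>Ensures that the \<open>lim\<close> in \<open>S_hat_qnorm\<close> is a genuine limit.
  Subadditivity of \<open>p\<close>-th powers makes the \<open>p\<close>-th powers of the
  quasi-norms a Cauchy sequence of reals; the root is taken afterwards.\<close>

lemma N_convergent:
  fixes u :: "nat \<Rightarrow> real \<Rightarrow> 'a::real_normed_field"
  assumes u: "u \<in> SC"
  shows "(\<lambda>n. N (u n)) \<longlonglongrightarrow> lim (\<lambda>n. N (u n))"
proof -
  define r where "r n = enn2real (N (u n))" for n
  have r: "0 \<le> r n" "N (u n) = ennreal (r n)" for n
    using SC_imp_S[OF u, of n] by (auto simp: r_def S_iff)
  have le: "r m powr p \<le> r n powr p + e powr p" if "0 \<le> e" "N (\<lambda>x. u m x - u n x) \<le> ennreal e" for m n e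
  proof -
    note Cu = SC_imp_C_infinity[OF u]
    have "N (\<lambda>x. u n x + (u m x - u n x)) \<le> ennreal ((r n powr p + e powr p) powr (1 / p))"
      using r that by (intro N_add C_infinity_diff Cu) auto
    then have "r m \<le> (r n powr p + e powr p) powr (1 / p)"
      by (simp add: r)
    then show ?thesis
      using p r(1)[of m] by (simp add: powr_le_iff)
  qed
  have "Cauchy (\<lambda>n. r n powr p)"
  proof (rule metric_CauchyI)
    fix e :: real
    assume e: "0 < e"
    define d where "d = (e / 2) powr (1 / p)"
    have d: "0 < d" "d powr p = e / 2"
      using e p by (auto simp: d_def powr_powr)
    obtain n0 where n0 [rule_format]: "\<forall>m\<ge>n0. \<forall>n\<ge>n0. N (\<lambda>x. u m x - u n x) \<le> ennreal d"
      by (rule exE[OF SC_D[OF u d(1)]])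
    have "dist (r m powr p) (r n powr p) < e" if "n0 \<le> m" "n0 \<le> n" for m n
    proof -
      have "r m powr p \<le> r n powr p + d powr p" "r n powr p \<le> r m powr p + d powr p"
        using le[OF less_imp_le[OF d(1)]] n0 that by blast+
      with d(2) e show ?thesis
        unfolding dist_real_def by linarith
    qed
    then show "\<exists>n0. \<forall>m\<ge>n0. \<forall>n\<ge>n0. dist (r m powr p) (r n powr p) < e"
      by blast
  qed
  then obtain l where l: "(\<lambda>n. r n powr p) \<longlonglongrightarrow> l"
    unfolding Cauchy_convergent_iff convergent_def by blast
  have "(\<lambda>n. (r n powr p) powr (1 / p)) \<longlonglongrightarrow> l powr (1 / p)"
    using p by (intro tendsto_powr' l tendsto_const) auto
  then have "(\<lambda>n. N (u n)) \<longlonglongrightarrow> ennreal (l powr (1 / p))"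
    using tendsto_ennrealI p r(1) unfolding r(2) by (simp add: powr_powr)
  then show ?thesis
    by (simp add: limI)
qed

section \<open>Operations on equivalence classes\<close>

lemma S_rel_image_eq:
  fixes u v :: "nat \<Rightarrow> real \<Rightarrow> 'a::{real_normed_field, euclidean_space}"
  assumes "u \<in> SC" "v \<in> SC" "S_lim u = S_lim v"
  shows "S_rel p M `` {u} = S_rel p M `` {v}"
  using assms by (auto simp: S_rel_iff)

lemma S_hatE:
  assumes "A \<in> S_hat p M"
  obtains u where "u \<in> SC" "A = S_rel p M `` {u}"
  using assms by (auto simp: S_hat_def quotient_def)

text \<open>The operations are unions over all representatives. Each member of such a union has the
  same pointwise limit, hence by \<open>S_rel_iff\<close> is the same class.\<close>

lemma
  fixes u v :: "nat \<Rightarrow> real \<Rightarrow> 'a::{real_normed_field, euclidean_space}"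
  assumes u: "u \<in> SC" and v: "v \<in> SC"
  shows S_hat_add_eq: "S_hat_add p M (S_rel p M `` {u}) (S_rel p M `` {v}) =
      S_rel p M `` {\<lambda>n x. u n x + v n x}"
    and S_hat_diff_eq: "S_hat_diff p M (S_rel p M `` {u}) (S_rel p M `` {v}) =
      S_rel p M `` {\<lambda>n x. u n x - v n x}"
    and S_hat_scale_eq: "S_hat_scale p M c (S_rel p M `` {u}) = S_rel p M `` {\<lambda>n x. c * u n x}"
proof -
  define U V where "U = S_rel p M `` {u}" and "V = S_rel p M `` {v}"
  have ne: "U \<noteq> {}" "V \<noteq> {}"
    using u v by (auto simp: U_def V_def S_rel_iff)
  have U: "u' \<in> SC" "S_lim u' = S_lim u" if "u' \<in> U" for u'
    using that by (auto simp: U_def S_rel_iff)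
  have V: "v' \<in> SC" "S_lim v' = S_lim v" if "v' \<in> V" for v'
    using that by (auto simp: V_def S_rel_iff)
  have UN_const: "(\<Union>x\<in>A. F x) = K" if "A \<noteq> {}" "\<And>x. x \<in> A \<Longrightarrow> F x = K"
    for A and F :: "(nat \<Rightarrow> real \<Rightarrow> 'a) \<Rightarrow> (nat \<Rightarrow> real \<Rightarrow> 'a) set" and K
    using that by auto
  have "S_hat_add p M U V = S_rel p M `` {\<lambda>n x. u n x + v n x}"
    unfolding S_hat_add_def
  proof (intro UN_const ne S_rel_image_eq SC_add u v)
    fix u' v'
    assume uv: "u' \<in> U" "v' \<in> V"
    show "S_lim (\<lambda>n x. u' n x + v' n x) = S_lim (\<lambda>n x. u n x + v n x)"
      by (simp add: S_lim_add u v U[OF uv(1)] V[OF uv(2)])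
  qed (rule U V, assumption)+
  moreover have "S_hat_diff p M U V = S_rel p M `` {\<lambda>n x. u n x - v n x}"
    unfolding S_hat_diff_def
  proof (intro UN_const ne S_rel_image_eq SC_diff u v)
    fix u' v'
    assume uv: "u' \<in> U" "v' \<in> V"
    show "S_lim (\<lambda>n x. u' n x - v' n x) = S_lim (\<lambda>n x. u n x - v n x)"
      by (simp add: S_lim_diff u v U[OF uv(1)] V[OF uv(2)])
  qed (rule U V, assumption)+
  moreover have "S_hat_scale p M c U = S_rel p M `` {\<lambda>n x. c * u n x}"
    unfolding S_hat_scale_def
  proof (intro UN_const ne S_rel_image_eq SC_scale u)
    fix u'
    assume u': "u' \<in> U"
    show "S_lim (\<lambda>n x. c * u' n x) = S_lim (\<lambda>n x. c * u n x)"
      by (simp add: S_lim_scale u U[OF u'])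
  qed (rule U, assumption)
  ultimately show "S_hat_add p M (S_rel p M `` {u}) (S_rel p M `` {v}) = S_rel p M `` {\<lambda>n x. u n x + v n x}"
    "S_hat_diff p M (S_rel p M `` {u}) (S_rel p M `` {v}) = S_rel p M `` {\<lambda>n x. u n x - v n x}"
    "S_hat_scale p M c (S_rel p M `` {u}) = S_rel p M `` {\<lambda>n x. c * u n x}"
    by (simp_all add: U_def V_def)
qed

section \<open>The embedding and its properties\<close>

definition T :: "(nat \<Rightarrow> real \<Rightarrow> 'a::real_normed_vector) set \<Rightarrow> real \<Rightarrow> 'a" where
  "T A = S_lim (SOME u. u \<in> A)"

text \<open>The chosen representative is equivalent to \<open>u\<close>, so both have the same limit
  and the choice in \<open>T\<close> is immaterial.\<close>

lemma
  fixes u :: "nat \<Rightarrow> real \<Rightarrow> 'a::{real_normed_field, euclidean_space}"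
  assumes "u \<in> SC"
  shows S_rel_image_some: "(SOME v. v \<in> S_rel p M `` {u}) \<in> SC"
    and T_eq: "T (S_rel p M `` {u}) = S_lim u"
proof -
  define w where "w = (SOME v. v \<in> S_rel p M `` {u})"
  have "w \<in> S_rel p M `` {u}"
    unfolding w_def by (rule someI[of _ u]) (simp add: S_rel_iff assms)
  then have "w \<in> SC" "S_lim w = S_lim u"
    by (auto simp: S_rel_iff)
  then show "(SOME v. v \<in> S_rel p M `` {u}) \<in> SC" "T (S_rel p M `` {u}) = S_lim u"
    unfolding T_def w_def by simp_all
qed

text \<open>The bound of \<open>sup_bound\<close> passes to pointwise limits.
  \<open>S_hat_qnorm\<close> looks at the chosen representative \<open>w\<close>, so the argument
  runs through \<open>w\<close>, which has the same limit as \<open>u\<close>.\<close>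

lemma T_sup_bound:
  fixes u :: "nat \<Rightarrow> real \<Rightarrow> 'a::{real_normed_field, euclidean_space}"
  assumes u: "u \<in> SC" and a: "0 \<le> a" "S_hat_qnorm p M (S_rel p M `` {u}) < ennreal a"
  shows "norm (nderiv k (S_lim u) x) \<le> C k * a"
proof -
  define w where "w = (SOME v. v \<in> S_rel p M `` {u})"
  have w: "w \<in> SC" "S_lim w = S_lim u"
    using S_rel_image_some[OF u] T_eq[OF u] by (auto simp: w_def T_def)
  have "lim (\<lambda>n. N (w n)) < ennreal a"
    using a(2) by (simp add: S_hat_qnorm_def w_def)
  then have "\<forall>\<^sub>F n in sequentially. N (w n) < ennreal a"
    using N_convergent[OF w(1)] order_tendstoD(2) by blast
  then have "\<forall>\<^sub>F n in sequentially. norm (nderiv k (w n) x) \<le> C k * a"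
    by eventually_elim (use a SC_imp_S[OF w(1)] in \<open>auto intro!: sup_bound\<close>)
  then have "norm (nderiv k (S_lim w) x) \<le> C k * a"
    by (rule tendsto_upperbound[OF tendsto_norm[OF S_lim_nderiv_tendsto[OF w(1)]]]) simp
  then show ?thesis by (simp add: w)
qed

text \<open>By linearity it suffices to apply \<open>T_sup_bound\<close> to the classes of the
  differences, whose quasi-norms tend to zero.\<close>

lemma T_continuous:
  fixes A :: "(nat \<Rightarrow> real \<Rightarrow> 'a::{real_normed_field, euclidean_space}) set"
  assumes X: "\<And>n. X n \<in> S_hat p M" and A: "A \<in> S_hat p M" and lim: "S_hat_tendsto p M X A"
  shows "C_infinity_tendsto (\<lambda>n. T (X n)) (T A)"
  unfolding C_infinity_tendsto_def uniform_limit_iff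
proof (intro allI impI)
  fix k and e :: real
  assume e: "0 < e"
  obtain a where a: "a \<in> SC" "A = S_rel p M `` {a}"
    using S_hatE[OF A] .
  have "\<forall>n. \<exists>u. u \<in> SC \<and> X n = S_rel p M `` {u}"
    using S_hatE[OF X] by metis
  then obtain u where u: "\<And>n. u n \<in> SC" "\<And>n. X n = S_rel p M `` {u n}"
    by metis
  define d where "d = e / (2 * C k)"
  have d: "0 < d" "C k * d < e"
    using e C_pos[of k] by (auto simp: d_def)
  have "\<forall>\<^sub>F n in sequentially. S_hat_qnorm p M (S_rel p M `` {\<lambda>m x. u n m x - a m x}) < ennreal d"
    using lim d(1) order_tendstoD(2)[of _ 0 sequentially "ennreal d"]
    by (simp add: S_hat_tendsto_def u a S_hat_diff_eq)
  then show "\<forall>\<^sub>F n in sequentially. \<forall>x\<in>UNIV. dist (nderiv k (T (X n)) x) (nderiv k (T A) x) < e"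
  proof eventually_elim
    case (elim n)
    show ?case
    proof
      fix x
      have "norm (nderiv k (S_lim (\<lambda>m x. u n m x - a m x)) x) \<le> C k * d"
        using u a d(1) elim by (intro T_sup_bound SC_diff) auto
      with d(2) show "dist (nderiv k (T (X n)) x) (nderiv k (T A) x) < e"
        using u a by (simp add: T_eq S_lim_diff nderiv_diff S_lim_C_infinity dist_norm)
    qed
  qed
qed

lemma
  fixes A B :: "(nat \<Rightarrow> real \<Rightarrow> 'a::{real_normed_field, euclidean_space}) set"
  assumes A: "A \<in> S_hat p M"
  shows T_C_infinity: "T A \<in> C_infinity"
    and T_scale: "T (S_hat_scale p M c A) = (\<lambda>x. c * T A x)"
    and T_add: "B \<in> S_hat p M \<Longrightarrow> T (S_hat_add p M A B) = (\<lambda>x. T A x + T B x)"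
proof -
  obtain u where u: "u \<in> SC" "A = S_rel p M `` {u}"
    using S_hatE[OF A] .
  show "T A \<in> C_infinity"
    using u by (simp add: T_eq S_lim_C_infinity)
  show "T (S_hat_scale p M c A) = (\<lambda>x. c * T A x)"
    using u S_hat_scale_eq[OF u(1) u(1)] by (simp add: T_eq SC_scale S_lim_scale)
  show "T (S_hat_add p M A B) = (\<lambda>x. T A x + T B x)" if B: "B \<in> S_hat p M"
  proof -
    obtain v where "v \<in> SC" "B = S_rel p M `` {v}"
      using S_hatE[OF B] .
    with u show ?thesis
      by (simp add: T_eq S_hat_add_eq SC_add S_lim_add)
  qed
qed

text \<open>Equal images mean equal limits of representatives, and these determine the class by
  \<open>S_rel_image_eq\<close>.\<close>

lemma inj_on_T:
  "inj_on (T :: (nat \<Rightarrow> real \<Rightarrow> 'a::{real_normed_field, euclidean_space}) set \<Rightarrow> real \<Rightarrow> 'a) (S_hat p M)"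
  by (intro inj_onI) (metis S_hatE S_rel_image_eq T_eq)

lemma T_S_hat_of:
  fixes f :: "real \<Rightarrow> 'a::{real_normed_field, euclidean_space}"
  assumes "f \<in> S"
  shows "T (S_hat_of p M f) = f"
  using SC_const[OF assms] by (simp add: S_hat_of_def T_eq S_limI)

end

theorem theorem2p1:
  fixes p q :: real and M :: "nat \<Rightarrow> real"
  assumes "0 < p" and "p < 1" and "q = 1 - p"
    and "\<And>k. M k \<ge> 1"
    and "convergent_prod (\<lambda>k. M k powr (p * q powi (int k - 1)))"
  shows "\<exists>T :: (nat \<Rightarrow> real \<Rightarrow> 'a::{real_normed_field, euclidean_space}) set \<Rightarrow> (real \<Rightarrow> 'a).
    T ` S_hat p M \<subseteq> C_infinity \<and>
    (\<forall>A\<in>S_hat p M. \<forall>B\<in>S_hat p M. T (S_hat_add p M A B) = (\<lambda>x. T A x + T B x)) \<and>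
    (\<forall>c. \<forall>A\<in>S_hat p M. T (S_hat_scale p M c A) = (\<lambda>x. c * T A x)) \<and>
    inj_on T (S_hat p M) \<and>
    (\<forall>X A. (\<forall>n. X n \<in> S_hat p M) \<longrightarrow> A \<in> S_hat p M \<longrightarrow> S_hat_tendsto p M X A \<longrightarrow>
       C_infinity_tendsto (\<lambda>n. T (X n)) (T A)) \<and>
    (\<forall>f\<in>S_class p M. T (S_hat_of p M f) = f)"
proof -
  have M: "0 < M k" for k
    using assms(4)[of k] by simp
  \<comment> \<open>A convergent product of positive reals has a summable series of
    logarithms.\<close>
  have "summable (\<lambda>k. ln (M k powr (p * q powi (int k - 1))))"
    using M[THEN less_imp_neq] assms(5) by (intro summable_ln_real) auto
  \<comment> \<open>Multiplying by \<open>q / p\<close> turns the exponents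
    \<open>p * q powi (int k - 1)\<close> into \<open>q ^ k\<close>, including \<open>k = 0\<close>,
    where the power of \<open>q\<close> is negative.\<close>
  then have "summable (\<lambda>k. q / p * ln (M k powr (p * q powi (int k - 1))))"
    by (rule summable_mult)
  also have "(\<lambda>k. q / p * ln (M k powr (p * q powi (int k - 1)))) = (\<lambda>k. (1 - p) ^ k * ln (M k))"
    using M assms(1-3) by (simp add: fun_eq_iff ln_powr power_int_diff)
  finally interpret weights p M
    using assms by unfold_locales auto
  show ?thesis
    by (intro exI[of _ T] conjI ballI allI impI image_subsetI T_C_infinity T_add T_scale inj_on_T
        T_continuous T_S_hat_of) auto
qed

end
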